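(* Let $X,Y$ be metric spaces with $X$ complete, $F:X\times\mathbb{R}_+\rightrightarrows Y$ a set-valued mapping, $(\bar x,\bar y)\in\operatorname{gph}F_0$, and $\mu:[0,+\infty]\to[0,+\infty]$ an upper semicontinuous nondecreasing function. Suppose that there exist neighbourhoods $U$ of $\bar x$ and $V$ of $\bar y$ such that, for any $x\in U$ and $y\in V$, the mapping $\tau\mapsto F_\tau^{-1}(y)$ on $\mathbb{R}_+$ is outer semicontinuous at $0$ and, for some $\gamma>\delta(y,F,x)$ and any $t\in(0,\gamma)$ with $(x,t,y)\in\operatorname{gph}F$, one of the following sets of conditions is satisfied: (i) there are sequences of positive numbers $(b_n)_{n\ge0}$ and $(c_n)_{n\ge1}$ and a function $m:(0,\infty)\to(0,\infty)$ such that $m(\tau)\downarrow0$ as $\tau\downarrow0$, $c_n\downarrow0$ as $n\to\infty$, $d(x,F_{m(c_1)}^{-1}(y))<b_0$, $$d\left(u,F_{m(c_{n+1})}^{-1}(y)\right)<b_n\ \text{ for all } u\in F_{m(c_n)}^{-1}(y)\cap B\left(x,\sum_{i=0}^{n-1}b_i\right)\ (n=1,2,\ldots),$$ and $\sum_{n=0}^{\infty}b_n\le\mu(t)$; (ii) there are functions $b,m:(0,\infty)\to(0,\infty)$ such that $m(\tau)\downarrow0\Rightarrow\tau\downarrow0$ and, for any $\tau>0$ with $\mu(\tau)\le\mu(t)$, $\mu(\tau)\ge m(\tau)+\mu(b(\tau))$ and $$d\left(u,F_{b(\tau)}^{-1}(y)\right)<m(\tau)\ \text{ for all } u\in F_\tau^{-1}(y)\cap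 B(x,\mu(t)-\mu(\tau));$$ (iii) there are functions $b,m:(0,\infty)\to(0,\infty)$ such that $m(\tau)\downarrow0\Rightarrow\tau\downarrow0$ and, for any $\tau>0$ with $\mu(\tau)\le\mu(t)$, $\mu(\tau)\ge m(\tau)+\mu(b(\tau))$, $F_0^{-1}(B(y,\tau))\subset F_\tau^{-1}(y)$ and $$d\left(y,F_0(B(u,m(\tau)))\right)<b(\tau)\ \text{ for all } u\in F_\tau^{-1}(y)\cap B(x,\mu(t)-\mu(\tau)).$$ Then $F$ is regular at $(\bar x,\bar y)$ with functional modulus $\mu$, i.e. there exist neighbourhoods $U'$ of $\bar x$ and $V'$ of $\bar y$ such that $d(x,F_0^{-1}(y))\le\mu(\delta(y,F,x))$ for all $x\in U'$, $y\in V'$.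
   Context: $\mathbb{R}_+=[0,\infty)$. $B(x,r)$ is the open ball of radius $r>0$, $B(x,0)=\{x\}$, $B(x,+\infty)=X$; $(+\infty)-(+\infty):=0$. $d(x,C)=\inf_{c\in C}d(x,c)$, with $d(x,\emptyset)=+\infty$. Set-valued mappings have possibly empty values; $\operatorname{gph}F=\{(x,t,y)\mid y\in F(x,t)\}$, $F_t:=F(\cdot,t)$, $\operatorname{gph}F_0=\{(x,y)\mid y\in F(x,0)\}$, $F_t(A)=\bigcup_{z\in A}F(z,t)$ for $A\subset X$, $F_t^{-1}(y)=\{x\in X\mid y\in F(x,t)\}$, $F_t^{-1}(V)=\bigcup_{v\in V}F_t^{-1}(v)$ for $V\subset Y$, and $\delta(y,F,x):=\inf\{t>0\mid y\in F(x,t)\}$ (with $\inf\emptyset=+\infty$). A mapping $\Phi:\mathbb{R}_+\rightrightarrows X$ is outer semicontinuous at $\bar\tau$ if $\{z\in X\mid \liminf_{\tau\to\bar\tau,\,\tau\in\mathbb{R}_+}d(z,\Phi(\tau))=0\}\subset\Phi(\bar\tau)$. The notation $\downarrow0$ means convergence to $0$ through positive values; "$m(\tau)\downarrow0\Rightarrow\tau\downarrow0$" means: for any sequence of positive numbers $(\tau_n)$, if $m(\tau_n)\to0$ then $\tau_n\to0$. The set of conditions that is satisfied, and the objects in it, may depend on $(x,y)$ and $t$. *)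

theory Defs
  imports "HOL-Analysis.Analysis"
begin

text \<open>
  Extended nonnegative quantities live in \<^typ>\<open>ennreal\<close>. A set-valued mapping from
  \<open>X \<times> [0,\<infinity>)\<close> to \<open>Y\<close> is a function \<open>F :: 'a \<Rightarrow> real \<Rightarrow> 'b set\<close> whose values at
  negative second arguments are never used.
\<close>

text \<open>Unlike \<^const>\<open>infdist\<close>, the distance to the empty set is infinite.\<close>

definition edist :: "'a::metric_space \<Rightarrow> 'a set \<Rightarrow> ennreal" where
  "edist x C = (INF c\<in>C. ennreal (dist x c))"

text \<open>Unlike \<^const>\<open>eball\<close>, the ball of radius 0 is the singleton of its centre.\<close>

definition ext_ball :: "'a::metric_space \<Rightarrow> ennreal \<Rightarrow> 'a set" where
  "ext_ball x r = (if r = 0 then {x} else {u. ennreal (dist x u) < r})"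

text \<open>The built-in subtraction satisfies \<open>\<infinity> - \<infinity> = \<infinity>\<close>; the convention here is \<open>\<infinity> - \<infinity> = 0\<close>.\<close>

definition ext_diff :: "ennreal \<Rightarrow> ennreal \<Rightarrow> ennreal" where
  "ext_diff a b = (if a = \<infinity> \<and> b = \<infinity> then 0 else a - b)"

definition gph :: "('a \<Rightarrow> real \<Rightarrow> 'b set) \<Rightarrow> ('a \<times> real \<times> 'b) set" where
  "gph F = {(x, t, y). 0 \<le> t \<and> y \<in> F x t}"

definition gph0 :: "('a \<Rightarrow> real \<Rightarrow> 'b set) \<Rightarrow> ('a \<times> 'b) set" where
  "gph0 F = {(x, y). y \<in> F x 0}"

definition image_at :: "('a \<Rightarrow> real \<Rightarrow> 'b set) \<Rightarrow> real \<Rightarrow> 'a set \<Rightarrow> 'b set" where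
  "image_at F t A = (\<Union>z\<in>A. F z t)"

definition inv_at :: "('a \<Rightarrow> real \<Rightarrow> 'b set) \<Rightarrow> real \<Rightarrow> 'b \<Rightarrow> 'a set" where
  "inv_at F t y = {x. y \<in> F x t}"

definition inv_image_at :: "('a \<Rightarrow> real \<Rightarrow> 'b set) \<Rightarrow> real \<Rightarrow> 'b set \<Rightarrow> 'a set" where
  "inv_image_at F t V = (\<Union>v\<in>V. inv_at F t v)"

definition delta :: "'b \<Rightarrow> ('a \<Rightarrow> real \<Rightarrow> 'b set) \<Rightarrow> 'a \<Rightarrow> ennreal" where
  "delta y F x = (INF t\<in>{t. 0 < t \<and> y \<in> F x t}. ennreal t)"

text \<open>
  The filter excludes \<open>\<tau> = \<tau>0\<close> itself. Including it would make outer semicontinuity a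
  stronger property, additionally forcing \<open>\<Phi> \<tau>0\<close> to be closed.
\<close>

definition outer_semicontinuous_at :: "(real \<Rightarrow> 'a::metric_space set) \<Rightarrow> real \<Rightarrow> bool" where
  "outer_semicontinuous_at \<Phi> \<tau>0 \<longleftrightarrow>
     {z. Liminf (at \<tau>0 within {0..}) (\<lambda>\<tau>. edist z (\<Phi> \<tau>)) = 0} \<subseteq> \<Phi> \<tau>0"

definition upper_semicontinuous :: "(ennreal \<Rightarrow> ennreal) \<Rightarrow> bool" where
  "upper_semicontinuous f \<longleftrightarrow> (\<forall>x. Limsup (at x) f \<le> f x)"

definition small_values_at_small_args :: "(real \<Rightarrow> real) \<Rightarrow> bool" where
  "small_values_at_small_args m \<longleftrightarrow>
     (\<forall>\<tau> :: nat \<Rightarrow> real. (\<forall>n. 0 < \<tau> n) \<and> (\<lambda>n. m (\<tau> n)) \<longlonglongrightarrow> 0 \<longrightarrow> \<tau> \<longlonglongrightarrow> 0)"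

text \<open>
  In the three conditions below, functions \<open>(0,\<infinity>) \<rightarrow> (0,\<infinity>)\<close> are functions on the reals
  that are positive at positive arguments; the value \<open>c 0\<close> is irrelevant.
\<close>

definition condition_i ::
  "('a::metric_space \<Rightarrow> real \<Rightarrow> 'b::metric_space set) \<Rightarrow> (ennreal \<Rightarrow> ennreal) \<Rightarrow> 'a \<Rightarrow> 'b \<Rightarrow> real \<Rightarrow> bool"
where
  "condition_i F \<mu> x y t \<longleftrightarrow>
     (\<exists>(b :: nat \<Rightarrow> real) (c :: nat \<Rightarrow> real) (m :: real \<Rightarrow> real).
        (\<forall>n. 0 < b n) \<and> (\<forall>n\<ge>1. 0 < c n) \<and> (\<forall>\<tau>>0. 0 < m \<tau>) \<and>
        (m \<longlongrightarrow> 0) (at_right 0) \<and> c \<longlonglongrightarrow> 0 \<and>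
        edist x (inv_at F (m (c 1)) y) < ennreal (b 0) \<and>
        (\<forall>n\<ge>1. \<forall>u \<in> inv_at F (m (c n)) y \<inter> ball x (\<Sum>i<n. b i).
           edist u (inv_at F (m (c (Suc n))) y) < ennreal (b n)) \<and>
        (\<Sum>n. ennreal (b n)) \<le> \<mu> (ennreal t))"

definition condition_ii ::
  "('a::metric_space \<Rightarrow> real \<Rightarrow> 'b::metric_space set) \<Rightarrow> (ennreal \<Rightarrow> ennreal) \<Rightarrow> 'a \<Rightarrow> 'b \<Rightarrow> real \<Rightarrow> bool"
where
  "condition_ii F \<mu> x y t \<longleftrightarrow>
     (\<exists>(b :: real \<Rightarrow> real) (m :: real \<Rightarrow> real).
        (\<forall>\<tau>>0. 0 < b \<tau>) \<and> (\<forall>\<tau>>0. 0 < m \<tau>) \<and> small_values_at_small_args m \<and>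
        (\<forall>\<tau>>0. \<mu> (ennreal \<tau>) \<le> \<mu> (ennreal t) \<longrightarrow>
           \<mu> (ennreal \<tau>) \<ge> ennreal (m \<tau>) + \<mu> (ennreal (b \<tau>)) \<and>
           (\<forall>u \<in> inv_at F \<tau> y \<inter> ext_ball x (ext_diff (\<mu> (ennreal t)) (\<mu> (ennreal \<tau>))).
              edist u (inv_at F (b \<tau>) y) < ennreal (m \<tau>))))"

definition condition_iii ::
  "('a::metric_space \<Rightarrow> real \<Rightarrow> 'b::metric_space set) \<Rightarrow> (ennreal \<Rightarrow> ennreal) \<Rightarrow> 'a \<Rightarrow> 'b \<Rightarrow> real \<Rightarrow> bool"
where
  "condition_iii F \<mu> x y t \<longleftrightarrow>
     (\<exists>(b :: real \<Rightarrow> real) (m :: real \<Rightarrow> real).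
        (\<forall>\<tau>>0. 0 < b \<tau>) \<and> (\<forall>\<tau>>0. 0 < m \<tau>) \<and> small_values_at_small_args m \<and>
        (\<forall>\<tau>>0. \<mu> (ennreal \<tau>) \<le> \<mu> (ennreal t) \<longrightarrow>
           \<mu> (ennreal \<tau>) \<ge> ennreal (m \<tau>) + \<mu> (ennreal (b \<tau>)) \<and>
           inv_image_at F 0 (ball y \<tau>) \<subseteq> inv_at F \<tau> y \<and>
           (\<forall>u \<in> inv_at F \<tau> y \<inter> ext_ball x (ext_diff (\<mu> (ennreal t)) (\<mu> (ennreal \<tau>))).
              edist y (image_at F 0 (ball u (m \<tau>))) < ennreal (b \<tau>))))"

definition regular_at ::
  "('a::metric_space \<Rightarrow> real \<Rightarrow> 'b::metric_space set) \<Rightarrow> 'a \<Rightarrow> 'b \<Rightarrow> (ennreal \<Rightarrow> ennreal) \<Rightarrow> bool"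
where
  "regular_at F xbar ybar \<mu> \<longleftrightarrow>
     (\<exists>U V. xbar \<in> interior U \<and> ybar \<in> interior V \<and>
        (\<forall>x\<in>U. \<forall>y\<in>V. edist x (inv_at F 0 y) \<le> \<mu> (delta y F x)))"

end

theory Submission
  imports Defs
begin

text \<open>
  Fix \<open>x\<close> and \<open>y\<close>, and write \<open>S \<tau>\<close> for \<open>F\<^sub>\<tau>\<^sup>-\<^sup>1(y)\<close>. The heart of the matter is that
  \<open>d(x, S 0) \<le> \<mu>(t)\<close> for each admissible \<open>t\<close>; only the case \<open>\<mu>(t) < \<infinity>\<close> needs an argument.

  Condition (i) is an iteration scheme in disguise: starting at \<open>x\<close> one walks from
  \<open>S (m(c\<^sub>n))\<close> to \<open>S (m(c\<^sub>n\<^sub>+\<^sub>1))\<close> by a step shorter than \<open>b\<^sub>n\<close>. The steps are summable, so by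
  completeness the walk converges, to a point at distance at most \<open>\<Sum>b\<^sub>n \<le> \<mu>(t)\<close> from \<open>x\<close>; since
  \<open>m(c\<^sub>n) \<rightarrow> 0\<close>, outer semicontinuity at \<open>0\<close> puts the limit into \<open>S 0\<close>
  (\<open>edist_inv_at_0_le_if_condition_i\<close>).

  Condition (ii) reduces to (i) by iterating \<open>b\<close> from \<open>t\<close>, which gives \<open>\<tau>\<^sub>0 = t\<close>,
  \<open>\<tau>\<^sub>n\<^sub>+\<^sub>1 = b(\<tau>\<^sub>n)\<close>. The inequality \<open>\<mu>(\<tau>) \<ge> m(\<tau>) + \<mu>(b(\<tau>))\<close> telescopes to
  \<open>\<Sum>\<^sub>i\<^sub><\<^sub>n m(\<tau>\<^sub>i) \<le> \<mu>(t) - \<mu>(\<tau>\<^sub>n)\<close>: the walk never leaves the balls in which (ii) gives a next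
  step, its step lengths \<open>m(\<tau>\<^sub>n)\<close> have sum at most \<open>\<mu>(t)\<close>, and as they tend to \<open>0\<close> so do
  the \<open>\<tau>\<^sub>n\<close>. Condition (iii) implies (ii): a point near \<open>u\<close> at which some value of \<open>F\<^sub>0\<close> comes
  within \<open>b(\<tau>)\<close> of \<open>y\<close> lies in \<open>S (b(\<tau>))\<close>, by the inclusion of preimages at \<open>b(\<tau>)\<close>.

  Finally \<open>t\<close> may be taken equal to, or decreasing to, \<open>\<delta>(y,F,x)\<close>, and upper semicontinuity
  of \<open>\<mu>\<close> turns \<open>d(x, S 0) \<le> \<mu>(t)\<close> into \<open>d(x, S 0) \<le> \<mu>(\<delta>(y,F,x))\<close>.
\<close>

section \<open>Distances in the extended half-line\<close>

lemma edist_less_iff: "edist x C < r \<longleftrightarrow> (\<exists>c\<in>C. ennreal (dist x c) < r)"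
  by (simp add: edist_def INF_less_iff)

lemma edist_le: "c \<in> C \<Longrightarrow> edist x C \<le> ennreal (dist x c)"
  unfolding edist_def by (rule INF_lower)

lemma exists_dist_less_if_edist_less:
  assumes "edist x C < ennreal r"
  obtains c where "c \<in> C" "dist x c < r"
  using assms by (auto simp: edist_less_iff ennreal_less_iff)

lemma ennreal_le_if_add_le:
  fixes a b c :: ennreal
  assumes "a + b \<le> c"
  shows "a \<le> c" "b \<le> c"
  by (rule order_trans[OF add_increasing2[OF zero_le order_refl] assms])
    (rule order_trans[OF add_increasing[OF zero_le order_refl] assms])

section \<open>Limits of approximate solutions\<close>

text \<open>
  Outer semicontinuity speaks of a lower limit of distances along the full one-sided filter; for
  the iteration it is needed along a single sequence.
\<close>

lemma outer_semicontinuous_at_0_sequentially: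
  fixes u :: "nat \<Rightarrow> 'a::metric_space"
  assumes osc: "outer_semicontinuous_at \<Phi> 0"
    and pos: "\<And>n. 0 < s n" and s: "s \<longlonglongrightarrow> 0"
    and mem: "\<And>n. u n \<in> \<Phi> (s n)" and u: "u \<longlonglongrightarrow> z"
  shows "z \<in> \<Phi> 0"
proof -
  have s_at: "filterlim s (at 0 within {0..}) sequentially"
    using pos s by (auto simp: filterlim_at less_imp_le less_imp_neq[THEN not_sym])
  have dist_lim: "(\<lambda>n. ennreal (dist z (u n))) \<longlonglongrightarrow> 0"
    using tendsto_ennrealI[OF tendsto_dist[OF tendsto_const u, of z]] by simp
  have edist_lim: "(\<lambda>n. edist z (\<Phi> (s n))) \<longlonglongrightarrow> 0"
    by (rule tendsto_sandwich[OF _ _ tendsto_const[of 0] dist_lim]) (simp_all add: edist_le[OF mem])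
  have "Liminf (at 0 within {0..}) (\<lambda>\<tau>. edist z (\<Phi> \<tau>)) \<le> 0"
  proof (rule ccontr)
    assume "\<not> ?thesis"
    then have "0 < Liminf (at 0 within {0..}) (\<lambda>\<tau>. edist z (\<Phi> \<tau>))"
      by (simp only: not_le)
    then obtain e where "0 < e" and e: "e < Liminf (at 0 within {0..}) (\<lambda>\<tau>. edist z (\<Phi> \<tau>))"
      using dense by blast
    have "eventually (\<lambda>n. e < edist z (\<Phi> (s n))) sequentially"
      using eventually_compose_filterlim[OF less_LiminfD[OF e] s_at] .
    moreover have "eventually (\<lambda>n. edist z (\<Phi> (s n)) < e) sequentially"
      using edist_lim \<open>0 < e\<close> by (rule order_tendstoD)
    ultimately have "eventually (\<lambda>n. False) sequentially"
      by eventually_elim auto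
    then show False by simp
  qed
  with osc show ?thesis
    by (auto simp: outer_semicontinuous_at_def)
qed

lemma convergent_if_summable_steps:
  fixes u :: "nat \<Rightarrow> 'a::complete_space"
  assumes step: "\<And>n. dist (u n) (u (Suc n)) \<le> b n" and "summable b"
  obtains z where "u \<longlonglongrightarrow> z" "dist (u 0) z \<le> suminf b"
proof -
  have b0: "0 \<le> b n" for n
    using step[of n] zero_le_dist order_trans by blast
  have dist_le: "dist (u m) (u n) \<le> (\<Sum>i=m..<n. b i)" if "m \<le> n" for m n
    using that
  proof (induction n rule: dec_induct)
    case (step n)
    then show ?case
      using assms(1)[of n] dist_triangle[of "u m" "u (Suc n)" "u n"] by simp
  qed simp
  have "Cauchy u"
  proof (rule CauchyI')
    fix e :: real assume "0 < e"
    then obtain N where N: "\<And>m n. m \<ge> N \<Longrightarrow> norm (sum b {m..<n}) < e"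
      using \<open>summable b\<close> unfolding summable_Cauchy by blast
    show "\<exists>M. \<forall>m\<ge>M. \<forall>n>m. dist (u m) (u n) < e"
    proof (intro exI allI impI)
      fix m n assume "N \<le> m" "m < n"
      then show "dist (u m) (u n) < e"
        using dist_le[of m n] N[of m n] by simp
    qed
  qed
  then obtain z where z: "u \<longlonglongrightarrow> z"
    by (auto simp: Cauchy_convergent_iff convergent_def)
  moreover have "dist (u 0) z \<le> suminf b"
  proof (rule LIMSEQ_le_const2[OF tendsto_dist[OF tendsto_const z]])
    have "dist (u 0) (u n) \<le> suminf b" for n
      using dist_le[of 0 n] sum_le_suminf[OF \<open>summable b\<close>, of "{..<n}"] b0
      by (simp add: atLeast0LessThan)
    then show "\<exists>N. \<forall>n\<ge>N. dist (u 0) (u n) \<le> suminf b" by blast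
  qed
  ultimately show thesis by (rule that)
qed

section \<open>The bound at a single parameter\<close>

lemma edist_inv_at_0_le_if_condition_i:
  fixes F :: "'a::complete_space \<Rightarrow> real \<Rightarrow> 'b::metric_space set"
  assumes osc: "outer_semicontinuous_at (\<lambda>\<tau>. inv_at F \<tau> y) 0"
    and cond: "condition_i F \<mu> x y t" and fin: "\<mu> (ennreal t) < \<infinity>"
  shows "edist x (inv_at F 0 y) \<le> \<mu> (ennreal t)"
proof -
  obtain b c :: "nat \<Rightarrow> real" and m :: "real \<Rightarrow> real" where
    b: "\<And>n. 0 < b n" and c: "\<And>n. n \<ge> 1 \<Longrightarrow> 0 < c n" and m: "\<And>\<tau>. 0 < \<tau> \<Longrightarrow> 0 < m \<tau>"
    and m0: "(m \<longlongrightarrow> 0) (at_right 0)" and c0: "c \<longlonglongrightarrow> 0"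
    and first: "edist x (inv_at F (m (c 1)) y) < ennreal (b 0)"
    and step: "\<And>n u. n \<ge> 1 \<Longrightarrow> u \<in> inv_at F (m (c n)) y \<Longrightarrow> u \<in> ball x (\<Sum>i<n. b i) \<Longrightarrow>
                 edist u (inv_at F (m (c (Suc n))) y) < ennreal (b n)"
    and sum_le: "(\<Sum>n. ennreal (b n)) \<le> \<mu> (ennreal t)"
    using cond unfolding condition_i_def by blast
  \<comment> \<open>The starting point \<open>x\<close> need not belong to any preimage, so membership is demanded only from
    index \<open>1\<close> on; at index \<open>0\<close> the ball would moreover have radius \<open>0\<close> and be empty.\<close>
  define P where "P n v \<longleftrightarrow> (if n = 0 then v = x
      else v \<in> inv_at F (m (c n)) y \<and> dist x v < (\<Sum>i<n. b i))" for n v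
  have next_point: "\<exists>w. P (Suc n) w \<and> dist v w < b n" if "P n v" for n v
  proof (cases "n = 0")
    case True
    with that first show ?thesis
      by (auto simp: P_def elim: exists_dist_less_if_edist_less)
  next
    case False
    with that have "edist v (inv_at F (m (c (Suc n))) y) < ennreal (b n)"
      by (intro step) (auto simp: P_def)
    then obtain w where w: "w \<in> inv_at F (m (c (Suc n))) y" "dist v w < b n"
      by (rule exists_dist_less_if_edist_less)
    moreover have "dist x w < (\<Sum>i<Suc n. b i)"
      using dist_triangle[of x w v] w that False by (simp add: P_def)
    ultimately show ?thesis by (auto simp: P_def)
  qed
  have "\<exists>u. \<forall>n. P n (u n) \<and> dist (u n) (u (Suc n)) < b n"
    by (rule dependent_nat_choice) (use next_point in \<open>auto simp: P_def\<close>)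
  then obtain u where u: "\<And>n. P n (u n)" and dist_u: "\<And>n. dist (u n) (u (Suc n)) < b n"
    by blast
  have "summable b"
    using sum_le fin b by (intro summable_suminf_not_top) (auto simp: less_imp_le top_unique)
  then obtain z where z: "u \<longlonglongrightarrow> z" and xz: "dist (u 0) z \<le> suminf b"
    using convergent_if_summable_steps[of u b] dist_u less_imp_le by metis
  have "(\<lambda>n. m (c (Suc n))) \<longlonglongrightarrow> 0"
  proof (rule filterlim_compose[OF m0])
    show "filterlim (\<lambda>n. c (Suc n)) (at_right 0) sequentially"
      using LIMSEQ_Suc[OF c0] c
      by (auto simp: filterlim_at less_imp_neq[THEN not_sym])
  qed
  moreover have "u (Suc n) \<in> inv_at F (m (c (Suc n))) y" for n
    using u[of "Suc n"] by (simp add: P_def)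
  ultimately have "z \<in> inv_at F 0 y"
    using m c by (intro outer_semicontinuous_at_0_sequentially[OF osc _ _ _ LIMSEQ_Suc[OF z]]) auto
  then have "edist x (inv_at F 0 y) \<le> ennreal (dist x z)"
    by (rule edist_le)
  also have "\<dots> \<le> ennreal (suminf b)"
    using xz u[of 0] by (simp add: P_def ennreal_leI)
  also have "\<dots> = (\<Sum>n. ennreal (b n))"
    using b \<open>summable b\<close> by (simp add: suminf_ennreal2 less_imp_le)
  finally show ?thesis using sum_le by simp
qed

text \<open>
  Finiteness of \<open>\<mu>(t)\<close> makes the step lengths \<open>m(\<tau>\<^sub>n)\<close> summable; they therefore tend to \<open>0\<close>,
  and this is what forces \<open>\<tau>\<^sub>n \<rightarrow> 0\<close>. The witnesses for (i) are \<open>m(\<tau>\<^sub>n)\<close> as step lengths, \<open>\<tau>\<^sub>n\<close> as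
  parameters, and the identity.
\<close>

lemma condition_i_if_condition_ii:
  assumes cond: "condition_ii F \<mu> x y t" and t: "0 < t" "y \<in> F x t"
    and fin: "\<mu> (ennreal t) < \<infinity>"
  shows "condition_i F \<mu> x y t"
proof -
  obtain b m :: "real \<Rightarrow> real" where
    b: "\<And>\<tau>. 0 < \<tau> \<Longrightarrow> 0 < b \<tau>" and m: "\<And>\<tau>. 0 < \<tau> \<Longrightarrow> 0 < m \<tau>"
    and small: "small_values_at_small_args m"
    and main: "\<forall>\<tau>>0. \<mu> (ennreal \<tau>) \<le> \<mu> (ennreal t) \<longrightarrow>
       \<mu> (ennreal \<tau>) \<ge> ennreal (m \<tau>) + \<mu> (ennreal (b \<tau>)) \<and>
       (\<forall>u \<in> inv_at F \<tau> y \<inter> ext_ball x (ext_diff (\<mu> (ennreal t)) (\<mu> (ennreal \<tau>))).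
          edist u (inv_at F (b \<tau>) y) < ennreal (m \<tau>))"
    using cond unfolding condition_ii_def by blast
  have decrease: "ennreal (m \<tau>) + \<mu> (ennreal (b \<tau>)) \<le> \<mu> (ennreal \<tau>)"
    if "0 < \<tau>" "\<mu> (ennreal \<tau>) \<le> \<mu> (ennreal t)" for \<tau>
    using main that by blast
  have step: "edist u (inv_at F (b \<tau>) y) < ennreal (m \<tau>)"
    if "0 < \<tau>" "\<mu> (ennreal \<tau>) \<le> \<mu> (ennreal t)" "u \<in> inv_at F \<tau> y"
      "u \<in> ext_ball x (ext_diff (\<mu> (ennreal t)) (\<mu> (ennreal \<tau>)))" for \<tau> u
    using main that by blast
  define \<tau> where "\<tau> n = (b ^^ n) t" for n
  have \<tau>_Suc: "\<tau> (Suc n) = b (\<tau> n)" and \<tau>_0: "\<tau> 0 = t" for n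
    by (simp_all add: \<tau>_def)
  have pos: "0 < \<tau> n" for n
    by (induction n) (simp_all add: \<tau>_0 \<tau>_Suc t b)
  have telescope: "(\<Sum>i<n. ennreal (m (\<tau> i))) + \<mu> (ennreal (\<tau> n)) \<le> \<mu> (ennreal t)" for n
  proof (induction n)
    case 0
    show ?case by (simp add: \<tau>_0)
  next
    case (Suc n)
    then have "\<mu> (ennreal (\<tau> n)) \<le> \<mu> (ennreal t)"
      by (rule ennreal_le_if_add_le)
    note le_n = decrease[OF pos this]
    have "(\<Sum>i<Suc n. ennreal (m (\<tau> i))) + \<mu> (ennreal (\<tau> (Suc n)))
        \<le> (\<Sum>i<n. ennreal (m (\<tau> i))) + \<mu> (ennreal (\<tau> n))"
      using add_left_mono[OF le_n, of "\<Sum>i<n. ennreal (m (\<tau> i))"] by (simp add: \<tau>_Suc add.assoc)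
    also have "\<dots> \<le> \<mu> (ennreal t)" by (fact Suc)
    finally show ?case .
  qed
  have \<mu>_le: "\<mu> (ennreal (\<tau> n)) \<le> \<mu> (ennreal t)" for n
    using telescope[of n] by (rule ennreal_le_if_add_le)
  have sum_le: "(\<Sum>n. ennreal (m (\<tau> n))) \<le> \<mu> (ennreal t)"
    by (rule suminf_le_const[OF summableI ennreal_le_if_add_le(1)[OF telescope]])
  have "summable (\<lambda>n. m (\<tau> n))"
    using sum_le fin m[OF pos]
    by (intro summable_suminf_not_top) (auto simp: less_imp_le top_unique)
  then have \<tau>_lim: "\<tau> \<longlonglongrightarrow> 0"
    using small pos summable_LIMSEQ_zero unfolding small_values_at_small_args_def by blast
  have walk: "edist u (inv_at F (\<tau> (Suc n)) y) < ennreal (m (\<tau> n))"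
    if "n \<ge> 1" "u \<in> inv_at F (\<tau> n) y" and u: "u \<in> ball x (\<Sum>i<n. m (\<tau> i))" for n u
  proof -
    have "ennreal (dist x u) < ennreal (\<Sum>i<n. m (\<tau> i))"
      using u by (simp add: ennreal_lessI order_le_less_trans[OF zero_le_dist])
    also have "\<dots> = (\<Sum>i<n. ennreal (m (\<tau> i)))"
      using m[OF pos] by (simp add: sum_ennreal less_imp_le)
    also have "\<dots> \<le> \<mu> (ennreal t) - \<mu> (ennreal (\<tau> n))"
      using telescope[of n] order_le_less_trans[OF \<mu>_le[of n] fin]
      by (metis ennreal_add_diff_cancel_right ennreal_minus_mono infinity_ennreal_def
          less_irrefl order_refl)
    finally have "u \<in> ext_ball x (ext_diff (\<mu> (ennreal t)) (\<mu> (ennreal (\<tau> n))))"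
      using fin by (auto simp: ext_ball_def ext_diff_def)
    with step[OF pos \<mu>_le that(2)] show ?thesis
      by (simp add: \<tau>_Suc)
  qed
  have "x \<in> ext_ball x (ext_diff (\<mu> (ennreal t)) (\<mu> (ennreal t)))"
    using fin by (auto simp: ext_ball_def ext_diff_def)
  with step[OF \<open>0 < t\<close> order_refl] t
  have first: "edist x (inv_at F (\<tau> 1) y) < ennreal (m (\<tau> 0))"
    by (simp add: \<tau>_def inv_at_def)
  show ?thesis
    unfolding condition_i_def
    by (rule exI[of _ "\<lambda>n. m (\<tau> n)"], rule exI[of _ \<tau>], rule exI[of _ "\<lambda>r. r"])
      (use m pos \<tau>_lim first walk sum_le in auto)
qed

lemma condition_ii_if_condition_iii:
  assumes "condition_iii F \<mu> x y t"
  shows "condition_ii F \<mu> x y t"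
proof -
  obtain b m :: "real \<Rightarrow> real" where
    b: "\<forall>\<tau>>0. 0 < b \<tau>" and m: "\<forall>\<tau>>0. 0 < m \<tau>"
    and small: "small_values_at_small_args m"
    and main: "\<forall>\<tau>>0. \<mu> (ennreal \<tau>) \<le> \<mu> (ennreal t) \<longrightarrow>
       \<mu> (ennreal \<tau>) \<ge> ennreal (m \<tau>) + \<mu> (ennreal (b \<tau>)) \<and>
       inv_image_at F 0 (ball y \<tau>) \<subseteq> inv_at F \<tau> y \<and>
       (\<forall>u \<in> inv_at F \<tau> y \<inter> ext_ball x (ext_diff (\<mu> (ennreal t)) (\<mu> (ennreal \<tau>))).
          edist y (image_at F 0 (ball u (m \<tau>))) < ennreal (b \<tau>))"
    using assms unfolding condition_iii_def by (elim exE conjE) (rule that)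
  have decrease: "ennreal (m \<tau>) + \<mu> (ennreal (b \<tau>)) \<le> \<mu> (ennreal \<tau>)"
    if "0 < \<tau>" "\<mu> (ennreal \<tau>) \<le> \<mu> (ennreal t)" for \<tau>
    using main that by blast
  have "edist u (inv_at F (b \<tau>) y) < ennreal (m \<tau>)"
    if \<tau>: "0 < \<tau>" "\<mu> (ennreal \<tau>) \<le> \<mu> (ennreal t)" and u: "u \<in> inv_at F \<tau> y"
      "u \<in> ext_ball x (ext_diff (\<mu> (ennreal t)) (\<mu> (ennreal \<tau>)))" for \<tau> u
  proof -
    obtain v where "v \<in> image_at F 0 (ball u (m \<tau>))" and yv: "dist y v < b \<tau>"
      using main \<tau> u exists_dist_less_if_edist_less[of y _ "b \<tau>"] by blast
    then obtain z where uz: "dist u z < m \<tau>" and "v \<in> F z 0"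
      by (auto simp: image_at_def)
    \<comment> \<open>The inclusion is used at \<open>b \<tau>\<close> and not at \<open>\<tau>\<close>, which is legitimate because \<open>\<mu>\<close> does not
      increase along \<open>b\<close>.\<close>
    have "\<mu> (ennreal (b \<tau>)) \<le> \<mu> (ennreal t)"
      using ennreal_le_if_add_le(2)[OF decrease[OF \<tau>]] \<tau>(2) by (rule order_trans)
    then have "inv_image_at F 0 (ball y (b \<tau>)) \<subseteq> inv_at F (b \<tau>) y"
      using main b \<tau>(1) by blast
    moreover have "z \<in> inv_image_at F 0 (ball y (b \<tau>))"
      using \<open>v \<in> F z 0\<close> yv by (auto simp: inv_image_at_def inv_at_def)
    ultimately have "z \<in> inv_at F (b \<tau>) y" ..
    with uz show ?thesis
      by (auto simp: edist_less_iff ennreal_less_iff)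
  qed
  with b m small decrease show ?thesis
    unfolding condition_ii_def by blast
qed

section \<open>Passing to the critical parameter\<close>

text \<open>
  Either the infimum is attained, or it is approached by elements other than itself, to which the
  upper limit at the infimum applies.
\<close>

lemma le_at_Inf_if_upper_semicontinuous:
  fixes \<mu> :: "ennreal \<Rightarrow> ennreal"
  assumes usc: "upper_semicontinuous \<mu>" and \<gamma>: "Inf T < \<gamma>"
    and le: "\<And>s. s \<in> T \<Longrightarrow> s < \<gamma> \<Longrightarrow> e \<le> \<mu> s"
  shows "e \<le> \<mu> (Inf T)"
proof (rule ccontr)
  assume "\<not> ?thesis"
  then have less: "\<mu> (Inf T) < e" by simp
  have notin: "Inf T \<notin> T"
    using le \<gamma> less by fastforce
  have "Limsup (at (Inf T)) \<mu> < e"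
    using usc less unfolding upper_semicontinuous_def by (metis order_le_less_trans)
  then have "eventually (\<lambda>s. \<mu> s < e) (at (Inf T))"
    using Limsup_lessD by blast
  then have "eventually (\<lambda>s. \<mu> s < e) (at_right (Inf T))"
    by (rule filter_leD[OF at_le, rotated]) simp
  then obtain r where r: "Inf T < r" "\<And>s. Inf T < s \<Longrightarrow> s < r \<Longrightarrow> \<mu> s < e"
    using eventually_at_right[OF \<gamma>] by metis
  then obtain s where s: "s \<in> T" "s < min r \<gamma>"
    using \<gamma> by (metis Inf_less_iff min_less_iff_conj)
  moreover have "Inf T < s"
    using s(1) notin Inf_lower[of s T] by (metis order_le_imp_less_or_eq)
  ultimately show False
    using r(2)[of s] le[of s] by auto
qed

theorem theorem3p14:
  fixes F :: "'a::complete_space \<Rightarrow> real \<Rightarrow> 'b::metric_space set"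
    and xbar :: 'a and ybar :: 'b
    and \<mu> :: "ennreal \<Rightarrow> ennreal"
  assumes "(xbar, ybar) \<in> gph0 F"
    and "upper_semicontinuous \<mu>"
    and "mono \<mu>"
    and "\<exists>U V. xbar \<in> interior U \<and> ybar \<in> interior V \<and>
           (\<forall>x\<in>U. \<forall>y\<in>V.
              outer_semicontinuous_at (\<lambda>\<tau>. inv_at F \<tau> y) 0 \<and>
              (\<exists>\<gamma>::ennreal. \<gamma> > delta y F x \<and>
                 (\<forall>t::real. 0 < t \<and> ennreal t < \<gamma> \<and> (x, t, y) \<in> gph F \<longrightarrow>
                    condition_i F \<mu> x y t \<or> condition_ii F \<mu> x y t \<or> condition_iii F \<mu> x y t)))"
  shows "regular_at F xbar ybar \<mu>"
proof -
  have bound: "edist x (inv_at F 0 y) \<le> \<mu> (delta y F x)"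
    if osc: "outer_semicontinuous_at (\<lambda>\<tau>. inv_at F \<tau> y) 0"
      and \<gamma>: "\<gamma> > delta y F x"
      and conds: "\<forall>t::real. 0 < t \<and> ennreal t < \<gamma> \<and> (x, t, y) \<in> gph F \<longrightarrow>
        condition_i F \<mu> x y t \<or> condition_ii F \<mu> x y t \<or> condition_iii F \<mu> x y t"
    for x y and \<gamma> :: ennreal
    unfolding delta_def
  proof (rule le_at_Inf_if_upper_semicontinuous[OF assms(2)])
    fix s assume "s \<in> ennreal ` {t. 0 < t \<and> y \<in> F x t}" "s < \<gamma>"
    then obtain t where t: "s = ennreal t" "0 < t" "y \<in> F x t" "ennreal t < \<gamma>"
      by blast
    then have some_condition:
      "condition_i F \<mu> x y t \<or> condition_ii F \<mu> x y t \<or> condition_iii F \<mu> x y t"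
      using conds by (simp add: gph_def)
    show "edist x (inv_at F 0 y) \<le> \<mu> s"
    proof (cases "\<mu> s < \<infinity>")
      case True
      then have "condition_i F \<mu> x y t"
        using some_condition condition_i_if_condition_ii condition_ii_if_condition_iii t by blast
      then show ?thesis
        using edist_inv_at_0_le_if_condition_i[OF osc] True t by simp
    next
      case False
      then have "\<mu> s = \<infinity>" by (metis infinity_ennreal_def top.not_eq_extremum)
      then show ?thesis by simp
    qed
  qed (use \<gamma> in \<open>simp add: delta_def\<close>)
  obtain U V where "xbar \<in> interior U" "ybar \<in> interior V"
    and "\<forall>x\<in>U. \<forall>y\<in>V. outer_semicontinuous_at (\<lambda>\<tau>. inv_at F \<tau> y) 0 \<and>
       (\<exists>\<gamma>::ennreal. \<gamma> > delta y F x \<and>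
          (\<forall>t::real. 0 < t \<and> ennreal t < \<gamma> \<and> (x, t, y) \<in> gph F \<longrightarrow>
             condition_i F \<mu> x y t \<or> condition_ii F \<mu> x y t \<or> condition_iii F \<mu> x y t))"
    using assms(4) by blast
  then show ?thesis
    unfolding regular_at_def using bound by blast
qed

end
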